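(* Let $k$ and $l$ be two positive integers. Then $$\mathrm{S}_3(k,l)=\begin{cases}0 & \text{if } k\geq 1 \text{ and } l\equiv 1 \pmod 3,\\ 1 & \text{if } k=1 \text{ and } l\equiv 0 \text{ or } 2 \pmod 3,\\ 2 & \text{if } k\geq 2 \text{ and } l\equiv 0\text{ or } 2 \pmod 3.\end{cases}$$
   Context: Let $k,l,m$ be positive integers. A set of integers is called $l$-sum-free modulo $m$ if it contains no elements $x_1,\ldots,x_l,y$ (not necessarily distinct) satisfying $x_1+\cdots+x_l\equiv y \pmod m$. A $k$-partition of a set $S$ is a family $S_1,\ldots,S_k$ of subsets of $S$ (possibly empty) such that every element of $S$ is contained in exactly one of them. The generalized Schur number modulo $m$, denoted $\mathrm{S}_m(k,l)$, is the largest integer $n\geq 0$ for which the set $\{1,2,\ldots,n\}$ (empty if $n=0$) admits a $k$-partition into sets that are $l$-sum-free modulo $m$. *)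

theory Defs
  imports "HOL-Number_Theory.Cong"
begin

definition sum_free_mod :: "nat \<Rightarrow> nat \<Rightarrow> int set \<Rightarrow> bool" where
  "sum_free_mod m l A \<longleftrightarrow>
     \<not> (\<exists>x y. (\<forall>i\<in>{1..l}. x i \<in> A) \<and> y \<in> A \<and> [(\<Sum>i=1..l. x i) = y] (mod int m))"

definition is_k_partition :: "nat \<Rightarrow> 'a set \<Rightarrow> (nat \<Rightarrow> 'a set) \<Rightarrow> bool" where
  "is_k_partition k A P \<longleftrightarrow>
     (\<forall>i\<in>{1..k}. P i \<subseteq> A) \<and> (\<forall>a\<in>A. \<exists>!i. i \<in> {1..k} \<and> a \<in> P i)"

definition admits_sum_free_partition :: "nat \<Rightarrow> nat \<Rightarrow> nat \<Rightarrow> nat \<Rightarrow> bool" where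
  "admits_sum_free_partition m k l n \<longleftrightarrow>
     (\<exists>P. is_k_partition k {1..int n} P \<and> (\<forall>i\<in>{1..k}. sum_free_mod m l (P i)))"

text \<open>For positive \<open>m\<close> the maximum exists, see
  \<open>schur_mod_greatest\<close> below.\<close>

definition schur_mod :: "nat \<Rightarrow> nat \<Rightarrow> nat \<Rightarrow> nat" where
  "schur_mod m k l = (GREATEST n. admits_sum_free_partition m k l n)"

lemma admits_sum_free_partition_0: "admits_sum_free_partition m k l 0"
  unfolding admits_sum_free_partition_def is_k_partition_def sum_free_mod_def
  by (rule exI[of _ "\<lambda>_. {}"]) auto

lemma admits_sum_free_partition_less:
  assumes "m > 0" and "admits_sum_free_partition m k l n"
  shows "n < m"
proof (rule ccontr)
  assume "\<not> n < m"
  with assms(1) have m: "int m \<in> {1..int n}" by auto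
  from assms(2) obtain P where P: "is_k_partition k {1..int n} P"
    and sf: "\<forall>i\<in>{1..k}. sum_free_mod m l (P i)"
    unfolding admits_sum_free_partition_def by blast
  from P m obtain i where i: "i \<in> {1..k}" "int m \<in> P i"
    unfolding is_k_partition_def by blast
  have "[(\<Sum>j=1..l. (\<lambda>_. int m) j) = int m] (mod int m)"
    by (simp add: cong_def)
  with i have "\<not> sum_free_mod m l (P i)"
    unfolding sum_free_mod_def by (auto intro!: exI[of _ "\<lambda>_. int m"] exI[of _ "int m"])
  with sf i show False by blast
qed

lemma schur_mod_greatest:
  assumes "m > 0"
  shows "admits_sum_free_partition m k l (schur_mod m k l)"
    and "admits_sum_free_partition m k l n \<Longrightarrow> n \<le> schur_mod m k l"
proof -
  have bound: "\<And>n. admits_sum_free_partition m k l n \<Longrightarrow> n \<le> m"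
    using admits_sum_free_partition_less[OF assms] by (simp add: less_imp_le)
  show "admits_sum_free_partition m k l (schur_mod m k l)"
    unfolding schur_mod_def
    using admits_sum_free_partition_0 bound by (rule GreatestI_nat)
  show "n \<le> schur_mod m k l" if "admits_sum_free_partition m k l n"
    unfolding schur_mod_def using that bound by (rule Greatest_le_nat)
qed

end

theory Submission
  imports Defs
begin

text \<open>
  For the modulus \<open>3\<close> only the sets \<open>{1}\<close>, \<open>{2}\<close> and \<open>{1, 2}\<close> matter, since the element \<open>3\<close> is
  never allowed: \<open>l \<cdot> 3 \<equiv> 3\<close>. Repeating one element \<open>a\<close> produces the sum \<open>l \<cdot> a\<close>, so a block
  containing \<open>a\<close> forces \<open>l \<cdot> a \<not>\<equiv> a\<close>, and for a singleton block this is also sufficient.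
  If \<open>l \<equiv> 1\<close>, this already excludes every element. Otherwise both \<open>{1}\<close> and \<open>{2}\<close> are \<open>l\<close>-sum-free,
  so two blocks suffice for \<open>{1, 2}\<close> and one block suffices for \<open>{1}\<close>. One block does not suffice for
  \<open>{1, 2}\<close>: either \<open>l\<close> ones, or \<open>l - 1\<close> ones and a two, have a sum congruent to \<open>1\<close> or \<open>2\<close>.
\<close>

lemma not_sum_free_mod_if_fixed:
  assumes "a \<in> A" and "[int l * a = a] (mod int m)"
  shows "\<not> sum_free_mod m l A"
  unfolding sum_free_mod_def using assms
  by (auto intro!: exI[of _ "\<lambda>_. a"] exI[of _ a])

lemma sum_free_mod_singleton:
  assumes "\<not> [int l * a = a] (mod int m)"
  shows "sum_free_mod m l {a}"
proof -
  have "(\<Sum>i=1..l. x i) = int l * a" if "\<forall>i\<in>{1..l}. x i \<in> {a}" for x :: "nat \<Rightarrow> int"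
    using sum.cong[of "{1..l}" "{1..l}" x "\<lambda>_. a"] that by simp
  with assms show ?thesis
    unfolding sum_free_mod_def by (metis singletonD)
qed

lemma admits_sum_free_partition_imp_not_fixed:
  assumes "admits_sum_free_partition m k l n" and "a \<in> {1..int n}"
  shows "\<not> [int l * a = a] (mod int m)"
  using assms not_sum_free_mod_if_fixed
  unfolding admits_sum_free_partition_def is_k_partition_def by blast

text \<open>With at least \<open>n\<close> blocks available, every element gets its own block, so the necessary
  condition of \<open>admits_sum_free_partition_imp_not_fixed\<close> becomes sufficient.\<close>

lemma admits_sum_free_partition_singletons:
  assumes "n \<le> k" and "\<And>a. a \<in> {1..int n} \<Longrightarrow> \<not> [int l * a = a] (mod int m)"
  shows "admits_sum_free_partition m k l n"
proof -
  define P where "P = (\<lambda>i. if i \<le> n then {int i} else {})"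
  have "\<exists>!i. i \<in> {1..k} \<and> a \<in> P i" if "a \<in> {1..int n}" for a
    using that assms(1)
    by (intro ex1I[of _ "nat a"]) (auto simp: P_def split: if_splits)
  then have "is_k_partition k {1..int n} P"
    unfolding is_k_partition_def by (auto simp: P_def split: if_splits)
  moreover have "sum_free_mod m l (P i)" if "i \<in> {1..k}" for i
  proof (cases "i \<le> n")
    case True
    with that have "int i \<in> {1..int n}" by simp
    with True show ?thesis
      using sum_free_mod_singleton[OF assms(2)] by (simp add: P_def)
  next
    case False
    then show ?thesis by (simp add: P_def sum_free_mod_def)
  qed
  ultimately show ?thesis
    unfolding admits_sum_free_partition_def by blast
qed

text \<open>Sums of \<open>l\<close> elements of \<open>{1, 2}\<close> include \<open>l\<close> and \<open>l + 1\<close>. Among two consecutive integers at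
  least one is not divisible by \<open>3\<close>, hence is congruent to \<open>1\<close> or \<open>2\<close>.\<close>

lemma not_sum_free_mod_3_if_1_2:
  assumes "l > 0" and "1 \<in> A" and "2 \<in> A"
  shows "\<not> sum_free_mod 3 l A"
proof -
  have hit: "\<not> sum_free_mod 3 l A"
    if x: "\<forall>i\<in>{1..l}. x i \<in> A" and s: "(\<Sum>i=1..l. x i) mod 3 \<noteq> 0" for x :: "nat \<Rightarrow> int"
  proof -
    have "(\<Sum>i=1..l. x i) mod 3 = 1 \<or> (\<Sum>i=1..l. x i) mod 3 = 2"
      using s pos_mod_bound[of 3 "\<Sum>i=1..l. x i"] pos_mod_sign[of 3 "\<Sum>i=1..l. x i"]
      by linarith
    then have "[(\<Sum>i=1..l. x i) = 1] (mod int 3) \<or> [(\<Sum>i=1..l. x i) = 2] (mod int 3)"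
      by (simp add: cong_def)
    with x assms(2,3) show ?thesis unfolding sum_free_mod_def by blast
  qed
  show ?thesis
  proof (cases "int l mod 3 = 0")
    case False
    with hit[of "\<lambda>_. 1"] assms(2) show ?thesis by simp
  next
    case True
    let ?x = "\<lambda>i::nat. if i = 1 then 2 else 1 :: int"
    have "(\<Sum>i=1..l. ?x i) = 2 + (\<Sum>i=Suc 1..l. ?x i)"
      using assms(1) by (subst sum.atLeast_Suc_atMost) auto
    also have "(\<Sum>i=Suc 1..l. ?x i) = (\<Sum>i=Suc 1..l. 1)"
      by (rule sum.cong) auto
    finally have "(\<Sum>i=1..l. ?x i) = int l + 1"
      using assms(1) by simp
    moreover have "(int l + 1) mod 3 \<noteq> 0"
      using True by presburger
    ultimately show ?thesis
      using hit[of ?x] assms(2,3) by auto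
  qed
qed

lemma one_block_mod_3_bound:
  assumes "l > 0" and "admits_sum_free_partition 3 1 l n"
  shows "n \<le> 1"
proof (rule ccontr)
  assume "\<not> n \<le> 1"
  obtain P where P: "is_k_partition 1 {1..int n} P" and free: "sum_free_mod 3 l (P 1)"
    using assms(2) unfolding admits_sum_free_partition_def by auto
  have "a \<in> P 1" if "a \<in> {1..int n}" for a
  proof -
    from P that have "\<exists>!i. i \<in> {1..1} \<and> a \<in> P i"
      unfolding is_k_partition_def by (elim conjE) (rule bspec)
    then obtain i where "i \<in> {1..1}" and "a \<in> P i"
      by (elim ex1E conjE)
    then show ?thesis by simp
  qed
  with \<open>\<not> n \<le> 1\<close> have "1 \<in> P 1" and "2 \<in> P 1" by auto
  with free show False
    using not_sum_free_mod_3_if_1_2[OF assms(1)] by blast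
qed

theorem theorem1p2:
  fixes k l :: nat
  assumes "k > 0" and "l > 0"
  shows "(k \<ge> 1 \<and> [l = 1] (mod 3) \<longrightarrow> schur_mod 3 k l = 0) \<and>
         (k = 1 \<and> ([l = 0] (mod 3) \<or> [l = 2] (mod 3)) \<longrightarrow> schur_mod 3 k l = 1) \<and>
         (k \<ge> 2 \<and> ([l = 0] (mod 3) \<or> [l = 2] (mod 3)) \<longrightarrow> schur_mod 3 k l = 2)"
proof -
  let ?s = "schur_mod 3 k l"
  have attained: "admits_sum_free_partition 3 k l ?s"
    by (rule schur_mod_greatest(1)) simp
  have maximal: "n \<le> ?s" if "admits_sum_free_partition 3 k l n" for n
    using that by (rule schur_mod_greatest(2)[rotated]) simp
  have "?s \<le> 2"
    using admits_sum_free_partition_less[OF _ attained] by simp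
  have zero: "?s = 0" if "[l = 1] (mod 3)"
  proof (rule ccontr)
    assume "?s \<noteq> 0"
    then have "\<not> [int l * 1 = 1] (mod int 3)"
      by (intro admits_sum_free_partition_imp_not_fixed[OF attained]) simp
    with that show False
      using cong_int_iff[of l 1 3] by simp
  qed
  have lower: "n \<le> ?s"
    if l: "[l = 0] (mod 3) \<or> [l = 2] (mod 3)" and "n \<le> k" "n \<le> 2" for n
  proof (rule maximal, rule admits_sum_free_partition_singletons)
    fix a assume "a \<in> {1..int n}"
    with \<open>n \<le> 2\<close> have a: "a = 1 \<or> a = 2" by auto
    have "int l mod 3 \<noteq> 1" "(int l * 2) mod 3 \<noteq> 2"
      using l unfolding cong_def by presburger+
    with a show "\<not> [int l * a = a] (mod int 3)"
      by (auto simp: cong_def)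
  qed fact
  have one_block: "?s \<le> 1" if "k = 1"
    using one_block_mod_3_bound[OF assms(2)] attained that by simp
  show ?thesis
  proof (intro conjI impI; elim conjE)
    show "?s = 0" if "[l = 1] (mod 3)"
      using that by (rule zero)
    show "?s = 1" if "k = 1" "[l = 0] (mod 3) \<or> [l = 2] (mod 3)"
      using lower[OF that(2), of 1] one_block[OF that(1)] that(1) by linarith
    show "?s = 2" if "k \<ge> 2" "[l = 0] (mod 3) \<or> [l = 2] (mod 3)"
      using lower[OF that(2), of 2] \<open>?s \<le> 2\<close> that(1) by linarith
  qed
qed

end
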